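(* Let $d\ge1$ be an integer and $a\in\mathbb{C}$. Let $(u^{(m)}_1,u^{(m)}_2,\ldots,u^{(m)}_d)$, $m=0,1,\ldots,d$, be vectors of orthogonality (that is, regular vectors of linear functionals) satisfying $$(x-a)u^{(m+1)}_1=u^{(m)}_d,\qquad u^{(m+1)}_i=u^{(m)}_{i-1},\quad i=2,\ldots,d,\qquad m=0,1,\ldots,d-1 ,$$ let $\{P^{(m)}_n\}_{n\ge0}$, $m=0,1,\ldots,d$, be the corresponding monic $d$-OPS, and let $J^{(m)}$ be the Hessenberg banded matrix associated with $\{P_n^{(m)}\}$. Then there exist $d$ infinite lower triangular bidiagonal matrices $$L^{(m)}=\begin{pmatrix} 1\\ \gamma^{(m)}_1&1\\ &\gamma^{(m)}_2&\ddots\\ &&\ddots \end{pmatrix},\qquad m=1,\ldots,d,$$ and an infinite upper triangular bidiagonal matrix $$U=\begin{pmatrix} s_1&1\\ &s_2&1\\ &&\ddots&\ddots \end{pmatrix}$$ with complex entries, such that $$J^{(m)}-aI=L^{(m)}\cdots L^{(1)}\,U\,L^{(d)}\cdots L^{(m+1)},\qquad m=1,\ldots,d$$ (for $m=d$ the product to the right of $U$ is empty, so $J^{(d)}-aI=L^{(d)}\cdots L^{(1)}U$).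
   Context: $\mathcal{P}[x]$ is the space of polynomials in $x$ with complex coefficients. A linear functional is a linear map $u:\mathcal{P}[x]\to\mathbb{C}$, $q\mapsto\langle u,q\rangle$, and $(x-a)u$ is the functional defined by $\langle (x-a)u,q\rangle=\langle u,(x-a)q\rangle$. A sequence of polynomials $\{P_n\}_{n\ge0}$ with $\deg P_n=n$ for all $n$ is a $d$-orthogonal sequence ($d$-OPS) with respect to a vector of linear functionals $(u_1,\ldots,u_d)$ if for each $j=1,\ldots,d$: $$\langle u_j,x^kP_n\rangle=0\ \text{ for all } k\ge 0,\ n\ge kd+j,\qquad \langle u_j,x^kP_{dk+j-1}\rangle\neq 0\ \text{ for all } k\ge 0.$$ A vector $(u_1,\ldots,u_d)$ of linear functionals is called regular if such a sequence exists; it is then called a vector of orthogonality for $\{P_n\}$. The $d$-OPS with respect to a given regular vector is unique up to a nonzero constant factor for each polynomial; the monic $d$-OPS is the one in which every $P_n$ has leading coefficient $1$. By a known theorem of Van Iseghem, a monic $d$-OPS $\{P_n^{(m)}\}$ satisfies a unique $(d+2)$-term recurrence $$xP^{(m)}_n(x)=P^{(m)}_{n+1}(x)+\sum_{k=0}^{d}a^{(m)}_{n,n-k}P^{(m)}_{n-k}(x),\quad n\ge0,\qquad P^{(m)}_0=1,\quad P^{(m)}_{-1}=\cdots=P^{(m)}_{-d}=0,$$ with $a^{(m)}_{n,n-d}\neq0$ for $n\ge d$. The associated Hessenberg banded matrix $J^{(m)}=(J^{(m)}_{i,j})_{i,j\ge0}$ is the infinite matrix with $J^{(m)}_{n,n+1}=1$,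 $J^{(m)}_{n,n-k}=a^{(m)}_{n,n-k}$ for $0\le k\le \min(d,n)$, and all other entries $0$. $I$ is the infinite identity matrix. All blank entries of displayed matrices are $0$; products of these banded infinite matrices are well defined entrywise by finite sums. *)

theory Defs
  imports
    Complex_Main
    "HOL-Computational_Algebra.Polynomial"
    "HOL-Library.Groups_Big_Fun"
begin

section \<open>Linear functionals and d-orthogonality\<close>

type_synonym functional = "complex poly \<Rightarrow> complex"

abbreviation linear_functional :: "functional \<Rightarrow> bool" where
  "linear_functional \<equiv> Vector_Spaces.linear smult (*)"

definition poly_times_functional :: "complex poly \<Rightarrow> functional \<Rightarrow> functional" where
  "poly_times_functional p u = (\<lambda>q. u (p * q))"

text \<open>
  A vector of functionals is a function on indices of which only the values at
  \<open>1, \<dots>, d\<close> matter.  The condition \<open>P n \<noteq> 0\<close> is stated because the zero polynomial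
  has \<^const>\<open>degree\<close> \<open>0\<close>.
\<close>

definition d_OPS ::
    "nat \<Rightarrow> (nat \<Rightarrow> functional) \<Rightarrow> (nat \<Rightarrow> complex poly) \<Rightarrow> bool" where
  "d_OPS d u P \<longleftrightarrow>
     (\<forall>n. P n \<noteq> 0 \<and> degree (P n) = n) \<and>
     (\<forall>j\<in>{1..d}.
        (\<forall>k n. n \<ge> k * d + j \<longrightarrow> u j (monom 1 k * P n) = 0) \<and>
        (\<forall>k. u j (monom 1 k * P (d * k + j - 1)) \<noteq> 0))"

definition monic_d_OPS ::
    "nat \<Rightarrow> (nat \<Rightarrow> functional) \<Rightarrow> (nat \<Rightarrow> complex poly) \<Rightarrow> bool" where
  "monic_d_OPS d u P \<longleftrightarrow> d_OPS d u P \<and> (\<forall>n. lead_coeff (P n) = 1)"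

definition regular_vector :: "nat \<Rightarrow> (nat \<Rightarrow> functional) \<Rightarrow> bool" where
  "regular_vector d u \<longleftrightarrow>
     (\<forall>j\<in>{1..d}. linear_functional (u j)) \<and> (\<exists>P. d_OPS d u P)"

section \<open>Infinite matrices\<close>

type_synonym imat = "nat \<Rightarrow> nat \<Rightarrow> complex"

definition imat_id :: imat where
  "imat_id i j = (if i = j then 1 else 0)"

text \<open>
  \<^const>\<open>Sum_any\<close> sums over the indices with nonzero summand.  Only matrices with
  finitely many nonzero entries in each row are multiplied here, so this set is finite;
  on such matrices the product is associative.
\<close>

definition imat_mult :: "imat \<Rightarrow> imat \<Rightarrow> imat" where
  "imat_mult A B i j = Sum_any (\<lambda>k. A i k * B k j)"

definition imat_prod :: "imat list \<Rightarrow> imat" where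
  "imat_prod As = foldr imat_mult As imat_id"

text \<open>
  Rows and columns are numbered from \<open>0\<close>, while the entries \<open>\<gamma>\<^sub>1, \<gamma>\<^sub>2, \<dots>\<close> and
  \<open>s\<^sub>1, s\<^sub>2, \<dots>\<close> are numbered from \<open>1\<close>.
\<close>

definition lower_bidiagonal :: "(nat \<Rightarrow> complex) \<Rightarrow> imat" where
  "lower_bidiagonal \<gamma> i j = (if i = j then 1 else if i = j + 1 then \<gamma> i else 0)"

definition upper_bidiagonal :: "(nat \<Rightarrow> complex) \<Rightarrow> imat" where
  "upper_bidiagonal s i j = (if i = j then s (i + 1) else if j = i + 1 then 1 else 0)"

section \<open>The recurrence and its Hessenberg matrix\<close>

text \<open>
  The convention \<open>P\<^sub>-\<^sub>1 = \<dots> = P\<^sub>-\<^sub>d = 0\<close> is built in by stopping the sum at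
  \<open>min d n\<close>.
\<close>

definition satisfies_recurrence :: "nat \<Rightarrow> (nat \<Rightarrow> complex poly) \<Rightarrow> imat \<Rightarrow> bool" where
  "satisfies_recurrence d P a \<longleftrightarrow>
     P 0 = 1 \<and>
     (\<forall>n. [:0, 1:] * P n =
            P (n + 1) + (\<Sum>k=0..min d n. smult (a n (n - k)) (P (n - k)))) \<and>
     (\<forall>n\<ge>d. a n (n - d) \<noteq> 0)"

definition hessenberg_of_coeffs :: "nat \<Rightarrow> imat \<Rightarrow> imat" where
  "hessenberg_of_coeffs d a i j =
     (if j = i + 1 then 1 else if j \<le> i \<and> i \<le> j + d then a i j else 0)"

text \<open>
  The coefficients \<open>a n l\<close> are determined only for \<open>l \<le> n \<le> l + d\<close>, but these are the
  only ones entering the matrix, which is therefore unique; see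
  \<open>hessenberg_ex1\<close> below.
\<close>

definition hessenberg_matrix :: "nat \<Rightarrow> (nat \<Rightarrow> complex poly) \<Rightarrow> imat" where
  "hessenberg_matrix d P =
     (THE J. \<exists>a. satisfies_recurrence d P a \<and> J = hessenberg_of_coeffs d a)"

lemma graded_expansion:
  fixes P :: "nat \<Rightarrow> complex poly"
  assumes P: "\<And>n. P n \<noteq> 0 \<and> degree (P n) = n" and "degree q \<le> n"
  shows "\<exists>c. q = (\<Sum>k\<le>n. smult (c k) (P k))"
  using assms(2)
proof (induction n arbitrary: q)
  case 0
  then obtain b where b: "q = [:b:]" by (metis degree_0_id le_zero_eq)
  obtain e where e: "P 0 = [:e:]" using P[of 0] by (metis degree_0_id)
  with P[of 0] have "e \<noteq> 0" by auto
  with b e show ?case by (intro exI[of _ "\<lambda>_. b / e"]) simp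
next
  case (Suc n)
  have lc: "coeff (P (Suc n)) (Suc n) \<noteq> 0" using P[of "Suc n"] by (metis leading_coeff_0_iff)
  define b where "b = coeff q (Suc n) / coeff (P (Suc n)) (Suc n)"
  have "degree (q - smult b (P (Suc n))) \<le> n"
  proof (rule degree_le, intro allI impI)
    fix i assume "i > n"
    show "coeff (q - smult b (P (Suc n))) i = 0"
    proof (cases "i = Suc n")
      case True
      with lc show ?thesis by (simp add: b_def)
    next
      case False
      with \<open>i > n\<close> have "i > Suc n" by simp
      with Suc.prems P[of "Suc n"] show ?thesis by (simp add: coeff_eq_0)
    qed
  qed
  from Suc.IH[OF this] obtain c where
    c: "q - smult b (P (Suc n)) = (\<Sum>k\<le>n. smult (c k) (P k))" by blast
  have "(\<Sum>k\<le>Suc n. smult ((c(Suc n := b)) k) (P k)) =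
      (\<Sum>k\<le>n. smult (c k) (P k)) + smult b (P (Suc n))"
    by simp
  also have "\<dots> = q" by (simp flip: c)
  finally show ?case by metis
qed

lemma graded_independent:
  fixes P :: "nat \<Rightarrow> complex poly"
  assumes P: "\<And>n. P n \<noteq> 0 \<and> degree (P n) = n"
    and "(\<Sum>k\<le>n. smult (c k) (P k)) = 0" and "k \<le> n"
  shows "c k = 0"
  using assms(2,3)
proof (induction n)
  case 0
  with P[of 0] show ?case by auto
next
  case (Suc n)
  have "coeff (\<Sum>k\<le>n. smult (c k) (P k)) (Suc n) = 0"
    using P by (auto simp: coeff_sum coeff_eq_0 intro!: sum.neutral)
  with Suc.prems(1) have "c (Suc n) * coeff (P (Suc n)) (Suc n) = 0"
    by (metis add_0 coeff_0 coeff_add coeff_smult sum.atMost_Suc)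
  moreover have "coeff (P (Suc n)) (Suc n) \<noteq> 0" using P[of "Suc n"] by (metis leading_coeff_0_iff)
  ultimately have "c (Suc n) = 0" by simp
  with Suc show ?case by (cases "k = Suc n") auto
qed

lemma linear_functional_sum:
  assumes "linear_functional u"
  shows "u (\<Sum>k\<in>A. smult (c k) (q k)) = (\<Sum>k\<in>A. c k * u (q k))"
proof -
  interpret Vector_Spaces.linear smult "(*)" u by fact
  show ?thesis by (simp add: sum scale)
qed

lemma band_sum:
  fixes f :: "nat \<Rightarrow> 'a::comm_monoid_add"
  assumes "\<And>k. k + d < n \<Longrightarrow> f k = 0"
  shows "(\<Sum>k\<le>n. f k) = (\<Sum>k=0..min d n. f (n - k))"
proof -
  have "(\<Sum>k\<le>n. f k) = (\<Sum>k\<in>{n - d..n}. f k)"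
    using assms by (intro sum.mono_neutral_right) auto
  also have "\<dots> = (\<Sum>k=0..min d n. f (n - k))"
    by (rule sum.reindex_bij_witness[of _ "\<lambda>k. n - k" "\<lambda>k. n - k"]) auto
  finally show ?thesis .
qed

lemma recurrence_exists:
  assumes d: "d \<ge> 1" and lin: "\<forall>j\<in>{1..d}. linear_functional (u j)"
    and ops: "monic_d_OPS d u P"
  shows "\<exists>a. satisfies_recurrence d P a"
proof -
  have P: "\<And>n. P n \<noteq> 0 \<and> degree (P n) = n" and monic: "\<And>n. coeff (P n) n = 1"
    using ops unfolding monic_d_OPS_def d_OPS_def by auto
  have orth: "u j (monom 1 k * P n) = 0" if "j \<in> {1..d}" "n \<ge> k * d + j" for j k n
    using ops that unfolding monic_d_OPS_def d_OPS_def by blast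
  have nz: "u j (monom 1 k * P (d * k + j - 1)) \<noteq> 0" if "j \<in> {1..d}" for j k
    using ops that unfolding monic_d_OPS_def d_OPS_def by blast
  have "\<exists>c. [:0, 1:] * P n = P (n + 1) + (\<Sum>k=0..min d n. smult (c (n - k)) (P (n - k))) \<and>
      (n \<ge> d \<longrightarrow> c (n - d) \<noteq> 0)" for n
  proof -
    have "degree ([:0, 1:] * P n - P (n + 1)) \<le> n"
    proof (rule degree_le, intro allI impI)
      fix i assume "i > n"
      then obtain i' where i': "i = Suc i'" "i' \<ge> n" by (cases i) auto
      show "coeff ([:0, 1:] * P n - P (n + 1)) i = 0"
      proof (cases "i' = n")
        case True
        with i' monic[of n] monic[of "Suc n"] show ?thesis by simp
      next
        case False
        with i' P[of n] P[of "Suc n"] show ?thesis by (simp add: coeff_eq_0)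
      qed
    qed
    from graded_expansion[OF P this] obtain c where
      c: "[:0, 1:] * P n - P (n + 1) = (\<Sum>k\<le>n. smult (c k) (P k))" by blast
    have key: "c k * u j (monom 1 i * P k) = u j (monom 1 (Suc i) * P n)"
      if j: "j \<in> {1..d}" and k: "k = d * i + j - 1" "k \<le> n"
        and van: "\<And>l. l < k \<Longrightarrow> c l = 0" for i j k
    proof -
      have lu: "linear_functional (u j)" using lin j by blast
      then interpret Vector_Spaces.linear smult "(*)" "u j" .
      have "u j (monom 1 (Suc i) * P n) - u j (monom 1 i * P (n + 1)) =
          u j (monom 1 i * ([:0, 1:] * P n - P (n + 1)))"
        by (simp add: monom_Suc algebra_simps flip: diff)
      also have "\<dots> = u j (\<Sum>l\<le>n. smult (c l) (monom 1 i * P l))"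
        unfolding c by (simp add: sum_distrib_left)
      also have "\<dots> = (\<Sum>l\<le>n. c l * u j (monom 1 i * P l))"
        by (rule linear_functional_sum[OF lu])
      also have "\<dots> = (\<Sum>l\<in>{k}. c l * u j (monom 1 i * P l))"
      proof (rule sum.mono_neutral_right)
        show "\<forall>l\<in>{..n} - {k}. c l * u j (monom 1 i * P l) = 0"
        proof
          fix l assume "l \<in> {..n} - {k}"
          then consider "l < k" | "l > k" by fastforce
          then show "c l * u j (monom 1 i * P l) = 0"
          proof cases
            case 1
            then show ?thesis using van by simp
          next
            case 2
            then have "u j (monom 1 i * P l) = 0"
              using j k by (intro orth) (auto simp: mult.commute)
            then show ?thesis by simp
          qed
        qed
      qed (use k in auto)
      moreover have "u j (monom 1 i * P (n + 1)) = 0"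
        using j k by (intro orth) (auto simp: mult.commute)
      ultimately show ?thesis by simp
    qed
    define i where "i k = k div d" for k
    define j where "j k = k mod d + 1" for k
    have ij: "k = d * i k + j k - 1" "j k \<in> {1..d}" for k
      using d by (auto simp: i_def j_def Suc_le_eq)
    have van: "c k = 0" if "k + d < n" for k
      using that
    proof (induction k rule: less_induct)
      case (less k)
      have "c k * u (j k) (monom 1 (i k) * P k) = u (j k) (monom 1 (Suc (i k)) * P n)"
        using less by (intro key ij) auto
      also have "\<dots> = 0"
      proof (rule orth[OF ij(2)])
        show "Suc (i k) * d + j k \<le> n"
          using less.prems ij(1)[of k] ij(2)[of k] by (simp add: mult.commute)
      qed
      finally show ?case using nz[OF ij(2), of k "i k"] ij(1)[of k] by (metis mult_eq_0_iff)
    qed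
    have "c (n - d) \<noteq> 0" if "n \<ge> d"
    proof
      assume "c (n - d) = 0"
      define k where "k = n - d"
      have n: "n = d * Suc (i k) + j k - 1"
      proof -
        have "n = k + d" "1 \<le> j k" using that ij(2)[of k] by (auto simp: k_def)
        with ij(1)[of k] show ?thesis unfolding mult_Suc_right by linarith
      qed
      have "c k * u (j k) (monom 1 (i k) * P k) = u (j k) (monom 1 (Suc (i k)) * P n)"
        using van by (intro key ij) (auto simp: k_def)
      with \<open>c (n - d) = 0\<close> have "u (j k) (monom 1 (Suc (i k)) * P n) = 0"
        by (simp add: k_def)
      with nz[OF ij(2), of k "Suc (i k)", folded n] show False by contradiction
    qed
    moreover have "(\<Sum>k\<le>n. smult (c k) (P k)) =
        (\<Sum>k=0..min d n. smult (c (n - k)) (P (n - k)))"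
      using van by (intro band_sum) simp
    moreover have "[:0, 1:] * P n = P (n + 1) + (\<Sum>k\<le>n. smult (c k) (P k))"
      unfolding c[symmetric] by simp
    ultimately show ?thesis by (intro exI[of _ c]) simp
  qed
  then have "\<forall>n. \<exists>c. [:0, 1:] * P n =
      P (n + 1) + (\<Sum>k=0..min d n. smult (c (n - k)) (P (n - k))) \<and>
      (n \<ge> d \<longrightarrow> c (n - d) \<noteq> 0)"
    by blast
  from choice[OF this] obtain a where "\<And>n. [:0, 1:] * P n =
      P (n + 1) + (\<Sum>k=0..min d n. smult (a n (n - k)) (P (n - k))) \<and>
      (n \<ge> d \<longrightarrow> a n (n - d) \<noteq> 0)"
    by blast
  moreover have "P 0 = 1"
  proof -
    have "P 0 = [:coeff (P 0) 0:]" using P[of 0] by (metis degree_0_id)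
    then show ?thesis using monic[of 0] by simp
  qed
  ultimately show ?thesis unfolding satisfies_recurrence_def by blast
qed

lemma recurrence_unique:
  assumes P: "\<And>n. P n \<noteq> 0 \<and> degree (P n) = n"
    and a: "satisfies_recurrence d P a" and b: "satisfies_recurrence d P b"
  shows "hessenberg_of_coeffs d a = hessenberg_of_coeffs d b"
proof -
  have "a i j = b i j" if ij: "j \<le> i" "i \<le> j + d" for i j
  proof -
    define c where "c k = (if k + d < i then 0 else a i k - b i k)" for k
    have "(\<Sum>k\<le>i. smult (c k) (P k)) = (\<Sum>k=0..min d i. smult (c (i - k)) (P (i - k)))"
      by (intro band_sum) (simp add: c_def)
    also have "\<dots> = (\<Sum>k=0..min d i. smult (a i (i - k)) (P (i - k)) - smult (b i (i - k)) (P (i - k)))"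
      by (intro sum.cong) (auto simp: c_def smult_diff_left)
    also have "\<dots> = 0"
    proof -
      have "P (i + 1) + (\<Sum>k=0..min d i. smult (a i (i - k)) (P (i - k))) =
          P (i + 1) + (\<Sum>k=0..min d i. smult (b i (i - k)) (P (i - k)))"
        using a b unfolding satisfies_recurrence_def by metis
      then show ?thesis unfolding sum_subtractf by simp
    qed
    finally have "c j = 0" using graded_independent[OF P _ ij(1)] by blast
    with ij show ?thesis by (simp add: c_def)
  qed
  then show ?thesis unfolding hessenberg_of_coeffs_def by (intro ext) auto
qed

lemma hessenberg_ex1:
  assumes "d \<ge> 1" and "\<forall>j\<in>{1..d}. linear_functional (u j)" and "monic_d_OPS d u P"
  shows "\<exists>!J. \<exists>a. satisfies_recurrence d P a \<and> J = hessenberg_of_coeffs d a"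
proof -
  have "\<And>n. P n \<noteq> 0 \<and> degree (P n) = n"
    using assms(3) unfolding monic_d_OPS_def d_OPS_def by blast
  with recurrence_exists[OF assms] recurrence_unique show ?thesis by metis
qed

end

theory Submission
  imports Defs
begin

text \<open>
  Comparing orthogonality conditions gives \<open>P\<^sup>m\<^sup>+\<^sup>1 = L\<^sup>m\<^sup>+\<^sup>1 P\<^sup>m\<close>. The hypotheses also give
  \<open>(x - a) u\<^sup>d\<^sub>i = u\<^sup>0\<^sub>i\<close> for all \<open>i\<close>, whence \<open>(x - a) P\<^sup>0 = U P\<^sup>d\<close>. Therefore
  \<open>(x - a) P\<^sup>m = L\<^sup>m \<cdots> L\<^sup>1 (x - a) P\<^sup>0 = L\<^sup>m \<cdots> L\<^sup>1 U P\<^sup>d = L\<^sup>m \<cdots> L\<^sup>1 U L\<^sup>d \<cdots> L\<^sup>m\<^sup>+\<^sup>1 P\<^sup>m\<close>.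
  The left-hand side is \<open>(J\<^sup>m - a I) P\<^sup>m\<close>, and the entries of \<open>P\<^sup>m\<close> are linearly independent.
\<close>

section \<open>Row-finite matrices acting on sequences of polynomials\<close>

definition row_finite :: "imat \<Rightarrow> bool" where
  "row_finite A \<longleftrightarrow> (\<forall>i. finite {j. A i j \<noteq> 0})"

text \<open>The sequence \<open>P\<close> plays the role of an infinite column vector, so matrix
  identities can be checked as identities between polynomials.\<close>

definition imat_apply :: "imat \<Rightarrow> (nat \<Rightarrow> complex poly) \<Rightarrow> nat \<Rightarrow> complex poly" where
  "imat_apply A P i = Sum_any (\<lambda>j. smult (A i j) (P j))"

lemma row_finiteI:
  assumes "\<And>i j. A i j \<noteq> 0 \<Longrightarrow> j \<le> i + c"
  shows "row_finite A"
  unfolding row_finite_def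
proof
  fix i
  show "finite {j. A i j \<noteq> 0}"
    by (rule finite_subset[of _ "{..i + c}"]) (auto dest: assms)
qed

lemma imat_apply_superset:
  assumes "finite S" "{j. A i j \<noteq> 0} \<subseteq> S"
  shows "imat_apply A P i = (\<Sum>j\<in>S. smult (A i j) (P j))"
  unfolding imat_apply_def using assms by (intro Sum_any.expand_superset) auto

lemma imat_mult_superset:
  assumes "finite S" "{j. A i j \<noteq> 0} \<subseteq> S"
  shows "imat_mult A B i k = (\<Sum>j\<in>S. A i j * B j k)"
  unfolding imat_mult_def using assms by (intro Sum_any.expand_superset) auto

text \<open>The set \<open>T i\<close> contains the support of every row of \<open>B\<close> that
  row \<open>i\<close> of \<open>A\<close> meets. It supplies one finite range for all inner sums,
  which permits the interchange of summation in \<open>imat_apply_mult\<close>.\<close>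

lemma row_finite_support_mult:
  assumes A: "row_finite A" and B: "row_finite B"
  defines "S \<equiv> \<lambda>i. {j. A i j \<noteq> 0}"
  defines "T \<equiv> \<lambda>i. \<Union>j\<in>S i. {k. B j k \<noteq> 0}"
  shows "finite (S i)" "finite (T i)" "{k. imat_mult A B i k \<noteq> 0} \<subseteq> T i"
proof -
  show S: "finite (S i)" using A by (simp add: S_def row_finite_def)
  then show "finite (T i)" using B by (simp add: T_def row_finite_def)
  show "{k. imat_mult A B i k \<noteq> 0} \<subseteq> T i"
  proof
    fix k assume "k \<in> {k. imat_mult A B i k \<noteq> 0}"
    then have "(\<Sum>j\<in>S i. A i j * B j k) \<noteq> 0"
      using imat_mult_superset[OF S, of A i B k] by (simp add: S_def)
    then obtain j where "j \<in> S i" "A i j * B j k \<noteq> 0" by (meson sum.neutral)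
    then show "k \<in> T i" by (auto simp: T_def)
  qed
qed

lemma row_finite_mult:
  assumes "row_finite A" "row_finite B"
  shows "row_finite (imat_mult A B)"
  unfolding row_finite_def
  by (rule allI, rule finite_subset, rule row_finite_support_mult(3)[OF assms],
      rule row_finite_support_mult(2)[OF assms])

lemma smult_sum_right: "smult c (\<Sum>k\<in>S. f k) = (\<Sum>k\<in>S. smult c (f k))"
  by (induction S rule: infinite_finite_induct) (auto simp: smult_add_right)

lemma imat_apply_mult:
  assumes A: "row_finite A" and B: "row_finite B"
  shows "imat_apply (imat_mult A B) P = imat_apply A (imat_apply B P)"
proof
  fix i
  define S where "S = {j. A i j \<noteq> 0}"
  define T where "T = (\<Union>j\<in>S. {k. B j k \<noteq> 0})"
  have fin: "finite S" "finite T" "{k. imat_mult A B i k \<noteq> 0} \<subseteq> T"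
    using row_finite_support_mult[OF A B, of i] by (simp_all add: S_def T_def)
  have "imat_apply (imat_mult A B) P i = (\<Sum>k\<in>T. smult (imat_mult A B i k) (P k))"
    using fin by (intro imat_apply_superset)
  also have "\<dots> = (\<Sum>k\<in>T. \<Sum>j\<in>S. smult (A i j) (smult (B j k) (P k)))"
    using imat_mult_superset[OF fin(1), of A i B] by (simp add: S_def smult_sum)
  also have "\<dots> = (\<Sum>j\<in>S. smult (A i j) (\<Sum>k\<in>T. smult (B j k) (P k)))"
    by (subst sum.swap) (simp add: smult_sum_right)
  also have "\<dots> = (\<Sum>j\<in>S. smult (A i j) (imat_apply B P j))"
  proof (rule sum.cong[OF refl])
    fix j assume "j \<in> S"
    then have "{k. B j k \<noteq> 0} \<subseteq> T" by (auto simp: T_def)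
    then show "smult (A i j) (\<Sum>k\<in>T. smult (B j k) (P k)) = smult (A i j) (imat_apply B P j)"
      using imat_apply_superset[OF fin(2), of B j P] by simp
  qed
  also have "\<dots> = imat_apply A (imat_apply B P) i"
    using imat_apply_superset[OF fin(1), of A i] by (simp add: S_def)
  finally show "imat_apply (imat_mult A B) P i = imat_apply A (imat_apply B P) i" .
qed

lemma row_finite_id: "row_finite imat_id"
  by (rule row_finiteI[of _ 0]) (simp add: imat_id_def split: if_splits)

lemma imat_apply_id: "imat_apply imat_id P = P"
proof
  fix i
  show "imat_apply imat_id P i = P i"
    using imat_apply_superset[of "{i}" imat_id i P] by (simp add: imat_id_def)
qed

text \<open>Evaluates a product one factor at a time, from the right. Row-finiteness is carried
  through the induction because \<open>imat_apply_mult\<close> requires it of the remaining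
  product.\<close>

lemma imat_apply_prod:
  assumes "\<forall>A\<in>set As. row_finite A"
  shows "row_finite (imat_prod As) \<and> imat_apply (imat_prod As) P = foldr imat_apply As P"
  using assms
  by (induction As)
     (auto simp: imat_prod_def row_finite_id imat_apply_id row_finite_mult imat_apply_mult)

text \<open>Polynomials of distinct degrees are linearly independent, so the coefficients can be
  compared row by row. This turns an identity between sequences back into one between
  matrices.\<close>

lemma imat_apply_inject:
  assumes P: "\<And>n. P n \<noteq> 0 \<and> degree (P n) = n"
    and A: "row_finite A" and B: "row_finite B" and eq: "imat_apply A P = imat_apply B P"
  shows "A = B"
proof (intro ext)
  fix i j
  \<comment> \<open>The index \<open>j\<close> is adjoined since it may lie outside both
    supports.\<close>
  have "finite ({k. A i k \<noteq> 0} \<union> {k. B i k \<noteq> 0} \<union> {j})"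
    using A B by (simp add: row_finite_def)
  then obtain n where n: "{k. A i k \<noteq> 0} \<union> {k. B i k \<noteq> 0} \<union> {j} \<subseteq> {..n}"
    using finite_nat_iff_bounded_le by blast
  have "(\<Sum>k\<le>n. smult (A i k) (P k)) = (\<Sum>k\<le>n. smult (B i k) (P k))"
    using fun_cong[OF eq, of i] n
      imat_apply_superset[of "{..n}" A i P] imat_apply_superset[of "{..n}" B i P]
    by simp
  then have "(\<Sum>k\<le>n. smult (A i k - B i k) (P k)) = 0"
    by (simp add: smult_diff_left sum_subtractf)
  from graded_independent[OF P this, of j] n show "A i j = B i j" by simp
qed

section \<open>Bidiagonal and Hessenberg actions, and two-term expansions in a d-OPS\<close>

lemma row_finite_lower_bidiagonal: "row_finite (lower_bidiagonal \<gamma>)"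
  by (rule row_finiteI[of _ 0]) (simp add: lower_bidiagonal_def split: if_splits)

lemma row_finite_upper_bidiagonal: "row_finite (upper_bidiagonal s)"
  by (rule row_finiteI[of _ 1]) (simp add: upper_bidiagonal_def split: if_splits)

lemma imat_apply_lower_bidiagonal:
  "imat_apply (lower_bidiagonal \<gamma>) P 0 = P 0"
  "imat_apply (lower_bidiagonal \<gamma>) P (Suc n) = P (Suc n) + smult (\<gamma> (Suc n)) (P n)"
proof -
  have "{j. lower_bidiagonal \<gamma> 0 j \<noteq> 0} \<subseteq> {0}"
    and "{j. lower_bidiagonal \<gamma> (Suc n) j \<noteq> 0} \<subseteq> {n, Suc n}"
    by (auto simp: lower_bidiagonal_def split: if_splits)
  then have "imat_apply (lower_bidiagonal \<gamma>) P 0 =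
      (\<Sum>j\<in>{0}. smult (lower_bidiagonal \<gamma> 0 j) (P j))"
    and "imat_apply (lower_bidiagonal \<gamma>) P (Suc n) =
      (\<Sum>j\<in>{n, Suc n}. smult (lower_bidiagonal \<gamma> (Suc n) j) (P j))"
    by (intro imat_apply_superset; simp)+
  then show "imat_apply (lower_bidiagonal \<gamma>) P 0 = P 0"
    and "imat_apply (lower_bidiagonal \<gamma>) P (Suc n) = P (Suc n) + smult (\<gamma> (Suc n)) (P n)"
    by (simp_all add: lower_bidiagonal_def)
qed

lemma imat_apply_upper_bidiagonal:
  "imat_apply (upper_bidiagonal s) P n = P (Suc n) + smult (s (Suc n)) (P n)"
proof -
  have "{j. upper_bidiagonal s n j \<noteq> 0} \<subseteq> {n, Suc n}"
    by (auto simp: upper_bidiagonal_def split: if_splits)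
  then have "imat_apply (upper_bidiagonal s) P n =
      (\<Sum>j\<in>{n, Suc n}. smult (upper_bidiagonal s n j) (P j))"
    by (intro imat_apply_superset) simp
  then show ?thesis by (simp add: upper_bidiagonal_def)
qed

text \<open>The recurrence, read row by row, says that the Hessenberg matrix acts on
  \<open>P\<close> as multiplication by \<open>x\<close>.\<close>

lemma hessenberg_apply:
  fixes a :: complex
  assumes "d \<ge> 1" "\<forall>j\<in>{1..d}. linear_functional (u j)" "monic_d_OPS d u P"
  defines "J \<equiv> \<lambda>i j. hessenberg_matrix d P i j - a * imat_id i j"
  shows "row_finite J" "imat_apply J P = (\<lambda>i. [:-a, 1:] * P i)"
proof -
  obtain b where b: "satisfies_recurrence d P b"
    and H: "hessenberg_matrix d P = hessenberg_of_coeffs d b"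
    using theI'[OF hessenberg_ex1[OF assms(1-3)]] unfolding hessenberg_matrix_def by blast
  have supp: "j \<le> i + 1" if "J i j \<noteq> 0" for i j
    using that by (simp add: J_def H hessenberg_of_coeffs_def imat_id_def split: if_splits)
  then show "row_finite J" by (rule row_finiteI)
  show "imat_apply J P = (\<lambda>i. [:-a, 1:] * P i)"
  proof
    fix i
    let ?h = "hessenberg_of_coeffs d b"
    have "imat_apply J P i = (\<Sum>j\<le>Suc i. smult (J i j) (P j))"
      by (intro imat_apply_superset) (auto dest: supp)
    also have "\<dots> = (\<Sum>j\<le>i. smult (?h i j) (P j)) + P (Suc i) -
        (\<Sum>j\<le>Suc i. smult (a * imat_id i j) (P j))"
      by (simp add: J_def H smult_diff_left sum_subtractf hessenberg_of_coeffs_def)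
    also have "(\<Sum>j\<le>Suc i. smult (a * imat_id i j) (P j)) =
        (\<Sum>j\<le>Suc i. if j = i then smult a (P i) else 0)"
      by (rule sum.cong) (simp_all add: imat_id_def)
    \<comment> \<open>Below the band \<open>?h\<close> vanishes while \<open>b\<close> is arbitrary,
      so the sum is cut to the band before \<open>?h\<close> is replaced by
      \<open>b\<close>.\<close>
    also have "(\<Sum>j\<le>i. smult (?h i j) (P j)) =
        (\<Sum>k=0..min d i. smult (?h i (i - k)) (P (i - k)))"
      by (rule band_sum) (simp add: hessenberg_of_coeffs_def)
    also have "\<dots> = (\<Sum>k=0..min d i. smult (b i (i - k)) (P (i - k)))"
      by (rule sum.cong) (auto simp: hessenberg_of_coeffs_def)
    also have "\<dots> + P (Suc i) = [:0, 1:] * P i"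
      using b by (simp add: satisfies_recurrence_def)
    finally show "imat_apply J P i = [:-a, 1:] * P i" by simp
  qed
qed

text \<open>In the expansion of \<open>q\<close> along \<open>P\<close>, the vanishing conditions
  remove the coefficients below index \<open>n\<close> one after another, and monicity fixes the top
  one. Both the lower and the upper bidiagonal relations come from this.\<close>

lemma d_OPS_two_term:
  assumes d: "d \<ge> 1" and lin: "\<forall>j\<in>{1..d}. linear_functional (u j)"
    and ops: "monic_d_OPS d u P"
    and deg: "degree q = Suc n" and lead: "lead_coeff q = 1"
    and van: "\<And>j k. j \<in> {1..d} \<Longrightarrow> k * d + j \<le> n \<Longrightarrow> u j (monom 1 k * q) = 0"
  shows "\<exists>s. q = P (Suc n) + smult s (P n)"
proof -
  have P: "\<And>n. P n \<noteq> 0 \<and> degree (P n) = n" and monic: "\<And>n. coeff (P n) n = 1"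
    using ops unfolding monic_d_OPS_def d_OPS_def by auto
  have orth: "u j (monom 1 k * P n) = 0" if "j \<in> {1..d}" "n \<ge> k * d + j" for j k n
    using ops that unfolding monic_d_OPS_def d_OPS_def by blast
  have nz: "u j (monom 1 k * P (d * k + j - 1)) \<noteq> 0" if "j \<in> {1..d}" for j k
    using ops that unfolding monic_d_OPS_def d_OPS_def by blast
  from graded_expansion[OF P, of q "Suc n"] deg obtain c where
    c: "q = (\<Sum>l\<le>Suc n. smult (c l) (P l))" by auto
  have c0: "c l = 0" if "l < n" for l
    using that
  proof (induction l rule: less_induct)
    case (less l)
    \<comment> \<open>Division by \<open>d\<close> gives the pair with
      \<open>l = d * k + j - 1\<close>, for which \<open>u j\<close> does not annihilate
      \<open>monom 1 k * P l\<close>. Terms below \<open>l\<close> drop out by induction and those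
      above by orthogonality, which isolates \<open>c l\<close>.\<close>
    define k j where "k = l div d" and "j = l mod d + 1"
    have j: "j \<in> {1..d}" and l: "k * d + j = Suc l"
      using d by (auto simp: k_def j_def Suc_le_eq)
    have "0 = u j (monom 1 k * q)" using van[OF j] l less.prems by simp
    also have "\<dots> = u j (\<Sum>i\<le>Suc n. smult (c i) (monom 1 k * P i))"
      unfolding c by (simp add: sum_distrib_left distrib_left)
    also have "\<dots> = (\<Sum>i\<le>Suc n. c i * u j (monom 1 k * P i))"
      using lin j by (intro linear_functional_sum) blast
    also have "\<dots> = (\<Sum>i\<in>{l}. c i * u j (monom 1 k * P i))"
    proof (rule sum.mono_neutral_right)
      show "\<forall>i\<in>{..Suc n} - {l}. c i * u j (monom 1 k * P i) = 0"
      proof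
        fix i assume "i \<in> {..Suc n} - {l}"
        then consider "i < l" | "i \<ge> k * d + j" using l by fastforce
        then show "c i * u j (monom 1 k * P i) = 0"
          using less orth[OF j] by cases auto
      qed
    qed (use less.prems in auto)
    finally show ?case using nz[OF j, of k] l by (simp add: mult.commute)
  qed
  have "(\<Sum>l\<le>Suc n. smult (c l) (P l)) = (\<Sum>l\<in>{n, Suc n}. smult (c l) (P l))"
    using c0 by (intro sum.mono_neutral_right) auto
  with c have q: "q = smult (c (Suc n)) (P (Suc n)) + smult (c n) (P n)" by simp
  have "coeff q (Suc n) = c (Suc n)"
    using P[of n] monic[of "Suc n"] by (subst q) (simp add: coeff_eq_0)
  then have "c (Suc n) = 1" using lead deg by simp
  with q show ?thesis by auto
qed

section \<open>Factorization along the chain of vectors of functionals\<close>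

theorem theorem3:
  fixes d :: nat and a :: complex
    and u :: "nat \<Rightarrow> nat \<Rightarrow> functional"
    and P :: "nat \<Rightarrow> nat \<Rightarrow> complex poly"
  assumes "d \<ge> 1"
    and "\<And>m. m \<le> d \<Longrightarrow> regular_vector d (u m)"
    and "\<And>m. m < d \<Longrightarrow> poly_times_functional [:-a, 1:] (u (m + 1) 1) = u m d"
    and "\<And>m i. m < d \<Longrightarrow> i \<in> {2..d} \<Longrightarrow> u (m + 1) i = u m (i - 1)"
    and "\<And>m. m \<le> d \<Longrightarrow> monic_d_OPS d (u m) (P m)"
  shows "\<exists>(\<gamma> :: nat \<Rightarrow> nat \<Rightarrow> complex) (s :: nat \<Rightarrow> complex).
           \<forall>m\<in>{1..d}.
             (\<lambda>i j. hessenberg_matrix d (P m) i j - a * imat_id i j) =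
             imat_prod (map (\<lambda>k. lower_bidiagonal (\<gamma> k)) (rev [1..<m + 1]) @
                        [upper_bidiagonal s] @
                        map (\<lambda>k. lower_bidiagonal (\<gamma> k)) (rev [m + 1..<d + 1]))"
proof -
  have lin: "\<forall>j\<in>{1..d}. linear_functional (u m j)" if "m \<le> d" for m
    using assms(2)[OF that] by (simp add: regular_vector_def)
  have deg: "P m n \<noteq> 0 \<and> degree (P m n) = n" and lead: "lead_coeff (P m n) = 1"
    if "m \<le> d" for m n
    using assms(5)[OF that] by (auto simp: monic_d_OPS_def d_OPS_def)
  have orth: "u m j (monom 1 k * P m n) = 0" if "m \<le> d" "j \<in> {1..d}" "n \<ge> k * d + j" for m j k n
    using assms(5)[OF that(1)] that unfolding monic_d_OPS_def d_OPS_def by blast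

  have "\<exists>g. P (Suc m) (Suc n) = P m (Suc n) + smult g (P m n)" if m: "m < d" for m n
  proof (rule d_OPS_two_term[OF \<open>d \<ge> 1\<close> lin assms(5)])
    fix j k assume j: "j \<in> {1..d}" and k: "k * d + j \<le> n"
    show "u m j (monom 1 k * P (Suc m) (Suc n)) = 0"
    proof (cases "j = d")
      case True
      \<comment> \<open>The factor \<open>x - a\<close> raises the power to \<open>Suc k\<close>.
        Orthogonality then asks for \<open>Suc k * d + 1 \<le> Suc n\<close>, which is exactly
        \<open>k * d + d \<le> n\<close>.\<close>
      have "u m d (monom 1 k * P (Suc m) (Suc n)) =
          u (Suc m) 1 ([:-a, 1:] * (monom 1 k * P (Suc m) (Suc n)))"
        using assms(3)[OF m] by (metis Suc_eq_plus1 poly_times_functional_def)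
      also have "[:-a, 1:] * (monom 1 k * P (Suc m) (Suc n)) =
          monom 1 (Suc k) * P (Suc m) (Suc n) - smult a (monom 1 k * P (Suc m) (Suc n))"
        by (simp add: monom_Suc algebra_simps)
      also have "u (Suc m) 1 \<dots> = u (Suc m) 1 (monom 1 (Suc k) * P (Suc m) (Suc n)) -
          a * u (Suc m) 1 (monom 1 k * P (Suc m) (Suc n))"
      proof -
        interpret Vector_Spaces.linear smult "(*)" "u (Suc m) 1"
          using lin[of "Suc m"] m by auto
        show ?thesis by (simp only: diff scale)
      qed
      also have "\<dots> = 0"
        using m k True \<open>d \<ge> 1\<close> by (simp add: orth)
      finally show ?thesis using True by simp
    next
      case False
      then have "u (Suc m) (Suc j) = u m j" using assms(4)[OF m, of "Suc j"] j by simp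
      moreover have "u (Suc m) (Suc j) (monom 1 k * P (Suc m) (Suc n)) = 0"
        using j k m False by (intro orth) auto
      ultimately show ?thesis by simp
    qed
  qed (use m deg[of "Suc m"] lead[of "Suc m"] in auto)
  then have "\<forall>m n. \<exists>g. m < d \<longrightarrow> P (Suc m) (Suc n) = P m (Suc n) + smult g (P m n)" by blast
  then obtain g where g: "\<And>m n. m < d \<Longrightarrow> P (Suc m) (Suc n) = P m (Suc n) + smult (g m n) (P m n)"
    by metis
  \<comment> \<open>\<open>g m n\<close> describes the passage from \<open>m\<close> to
    \<open>Suc m\<close> in row \<open>Suc n\<close>, while \<open>\<gamma>\<close> is indexed by
    the target of the passage and by the row itself.\<close>
  define \<gamma> where "\<gamma> m n = g (m - 1) (n - 1)" for m n
  define L where "L k = lower_bidiagonal (\<gamma> k)" for k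
  have P0: "P m 0 = 1" if "m \<le> d" for m
    using deg[OF that, of 0] lead[OF that, of 0] by (metis degree_0_id one_pCons)
  \<comment> \<open>The common factor \<open>q\<close> lets one statement serve both
    \<open>P m\<close> and its multiple by \<open>x - a\<close>.\<close>
  have step: "imat_apply (L (Suc m)) (\<lambda>i. q * P m i) = (\<lambda>i. q * P (Suc m) i)"
    if "m < d" for m q
  proof
    fix i
    show "imat_apply (L (Suc m)) (\<lambda>i. q * P m i) i = q * P (Suc m) i"
      using that by (cases i)
        (simp_all add: L_def imat_apply_lower_bidiagonal P0 g \<gamma>_def distrib_left)
  qed
  have chain: "foldr imat_apply (map L (rev [m + 1..<n + 1])) (\<lambda>i. q * P m i) = (\<lambda>i. q * P n i)"
    if "m \<le> n" "n \<le> d" for m n q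
    using that by (induction n rule: dec_induct) (simp_all add: step)

  have shift: "u (m + i) (j + i) = u m j" if "m + i \<le> d" "j \<ge> 1" "j + i \<le> d" for m i j
    using that
  proof (induction i)
    case (Suc i)
    then show ?case using assms(4)[of "m + i" "j + Suc i"] by simp
  qed simp
  \<comment> \<open>Follow the diagonal from \<open>u d i\<close> down to
    \<open>u (d - i + 1) 1\<close>, cross to \<open>u (d - i) d\<close>, and follow the next
    diagonal to \<open>u 0 i\<close>. The factor \<open>x - a\<close> is met exactly once, at the
    crossing.\<close>
  have ends: "u d i ([:-a, 1:] * q) = u 0 i q" if i: "i \<in> {1..d}" for i q
  proof -
    have "u d i = u (d - i + 1) 1" using shift[of "d - i + 1" "i - 1" 1] i by simp
    moreover have "u (d - i) d = u 0 i" using shift[of 0 "d - i" i] i by simp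
    moreover have "u (d - i + 1) 1 ([:-a, 1:] * q) = u (d - i) d q"
      using assms(3)[of "d - i"] i by (metis poly_times_functional_def diff_less
          atLeastAtMost_iff less_le_trans zero_less_one)
    ultimately show ?thesis by simp
  qed
  \<comment> \<open>By \<open>ends\<close>, pairing this product with \<open>u d\<close> amounts to
    pairing \<open>P 0 n\<close> with \<open>u 0\<close>, so the orthogonality of \<open>P 0\<close>
    supplies the vanishing conditions.\<close>
  have "\<exists>s. [:-a, 1:] * P 0 n = P d (Suc n) + smult s (P d n)" for n
  proof (rule d_OPS_two_term[OF \<open>d \<ge> 1\<close> lin assms(5)])
    show "degree ([:-a, 1:] * P 0 n) = Suc n"
      using deg[of 0 n] by (simp add: degree_mult_eq del: mult_pCons_left)
    show "lead_coeff ([:-a, 1:] * P 0 n) = 1"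
      using lead[of 0 n] by (simp add: lead_coeff_mult del: mult_pCons_left)
    fix j k assume "j \<in> {1..d}" "k * d + j \<le> n"
    then show "u d j (monom 1 k * ([:-a, 1:] * P 0 n)) = 0"
      using ends[of j "monom 1 k * P 0 n"] orth[of 0 j k n] by (simp only: mult.left_commute)
  qed simp_all
  then obtain s' where s': "\<And>n. [:-a, 1:] * P 0 n = P d (Suc n) + smult (s' n) (P d n)"
    by metis
  define s where "s n = s' (n - 1)" for n
  have U: "imat_apply (upper_bidiagonal s) (P d) = (\<lambda>i. [:-a, 1:] * P 0 i)"
    by (rule ext) (simp only: imat_apply_upper_bidiagonal s' s_def diff_Suc_1)

  show ?thesis
  proof (intro exI ballI)
    fix m assume m: "m \<in> {1..d}"
    let ?As = "map L (rev [1..<m + 1]) @ [upper_bidiagonal s] @ map L (rev [m + 1..<d + 1])"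
    have "\<forall>A\<in>set ?As. row_finite A"
      by (auto simp: L_def row_finite_lower_bidiagonal row_finite_upper_bidiagonal)
    note prod = imat_apply_prod[OF this, of "P m"]
    \<comment> \<open>The rightmost run uses \<open>q = 1\<close> and climbs from \<open>m\<close>
      to \<open>d\<close>, being empty for \<open>m = d\<close>. After \<open>U\<close>, the other
      run climbs from \<open>0\<close> to \<open>m\<close> with \<open>q = x - a\<close>.\<close>
    have "foldr imat_apply ?As (P m) = (\<lambda>i. [:-a, 1:] * P m i)"
      using m chain[of m d 1] chain[of 0 m "[:-a, 1:]"] U
      by (simp del: upt_Suc mult_pCons_left)
    moreover from m have "m \<le> d" by simp
    note hessenberg_apply[OF \<open>d \<ge> 1\<close> lin[OF this] assms(5)[OF this], of a]
    ultimately have "(\<lambda>i j. hessenberg_matrix d (P m) i j - a * imat_id i j) = imat_prod ?As"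
      using m prod deg[of m] by (intro imat_apply_inject[of "P m"]) auto
    then show "(\<lambda>i j. hessenberg_matrix d (P m) i j - a * imat_id i j) =
        imat_prod (map (\<lambda>k. lower_bidiagonal (\<gamma> k)) (rev [1..<m + 1]) @
          [upper_bidiagonal s] @ map (\<lambda>k. lower_bidiagonal (\<gamma> k)) (rev [m + 1..<d + 1]))"
      unfolding L_def .
  qed
qed

end
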